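(* Let $M$ be a Sasaki-Einstein $5$-manifold with $SU(2)$-structure $(\eta,\omega_1,\omega_2,\omega_3)$ and associated almost contact metric structures $(\phi_i,\xi,\eta,g)$, $i\in\{1,2,3\}$. Then the Okumura connection corresponding to $r=\frac12$ and associated to the Sasakian structure $(\phi_3,\xi,\eta,g)$ parallelizes the whole $SU(2)$-structure.
   Context: All manifolds are smooth and connected; $\nabla$ is the Levi-Civita connection of $g$; $d\eta(X,Y)=X(\eta(Y))-Y(\eta(X))-\eta([X,Y])$ and $u\wedge v=u\otimes v-v\otimes u$ for $1$-forms. An almost contact metric structure $(\phi,\xi,\eta,g)$ on $M^{2n+1}$ consists of a $(1,1)$-tensor field $\phi$, a vector field $\xi$, a $1$-form $\eta$ and a Riemannian metric $g$ with $\phi^2=-I+\eta\otimes\xi$, $\eta(\xi)=1$, $g(\phi X,\phi Y)=g(X,Y)-\eta(X)\eta(Y)$. It is Sasakian if $(\nabla_X\phi)Y=g(X,Y)\xi-\eta(Y)X$. An $SU(2)$-structure on a $5$-manifold is given equivalently by (i) three almost contact metric structures $(\phi_i,\xi,\eta,g)$, $i\in\{1,2,3\}$, with the same $\xi,\eta,g$ and $\phi_i\phi_j=\phi_k=-\phi_j\phi_i$ for every even permutation $(i,j,k)$ of $(1,2,3)$; or (ii) a quadruplet $(\eta,\omega_1,\omega_2,\omega_3)$ of a $1$-form and three $2$-forms with $\omega_i\wedge\omega_j=\delta_{ij}v$ for some $4$-form $v$ with $v\wedge\eta\neq0$ everywhere, and such that $X\lrcorner\,\omega_1=Y\lrcorner\,\omega_2$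 implies $\omega_3(X,Y)\ge0$. The two are related by $\omega_i(X,Y)=g(\phi_iX,Y)$. It is Sasaki-Einstein if $d\eta=-2\omega_3$, $d\omega_1=3\eta\wedge\omega_2$, $d\omega_2=-3\eta\wedge\omega_1$; then $(\phi_3,\xi,\eta,g)$ is Sasakian and $g$ is Einstein. The Okumura connection with parameter $r$ of a Sasakian structure $(\phi,\xi,\eta,g)$ is $\bar\nabla_XY=\nabla_XY+g(X,\phi Y)\xi-r\,\eta(X)\phi Y+\eta(Y)\phi X$. "Parallelizes the whole $SU(2)$-structure" means that all the tensors $\phi_1,\phi_2,\phi_3,\xi,\eta,g$ (equivalently $\eta,\omega_1,\omega_2,\omega_3$) are $\bar\nabla$-parallel. *)

theory Defs
  imports "HOL-Analysis.Analysis" "HOL-Library.Function_Algebras"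
begin

text \<open>Functions into a real vector space form a real vector space under pointwise operations.
  The instance applies both to tangent vectors and to vector fields, as they are modelled below.\<close>

instantiation "fun" :: (type, real_vector) real_vector
begin

definition scaleR_fun :: "real \<Rightarrow> ('a \<Rightarrow> 'b) \<Rightarrow> 'a \<Rightarrow> 'b" where
  "scaleR_fun c f = (\<lambda>x. c *\<^sub>R f x)"

instance
  by standard (simp_all add: scaleR_fun_def fun_eq_iff scaleR_add_right scaleR_add_left)

end

section \<open>Smooth manifolds\<close>

primrec Ck_on ::
  "nat \<Rightarrow> 'e::real_normed_vector set \<Rightarrow> ('e \<Rightarrow> 'b::real_normed_vector) \<Rightarrow> bool" where
  "Ck_on 0 S f \<longleftrightarrow> continuous_on S f"
| "Ck_on (Suc k) S f \<longleftrightarrow>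
     (\<forall>x\<in>S. f differentiable (at x)) \<and> (\<forall>v. Ck_on k S (\<lambda>x. frechet_derivative f (at x) v))"

text \<open>Meaningful for open \<open>S\<close> in a finite-dimensional space, the only case used.\<close>

definition smooth_on ::
  "'e::real_normed_vector set \<Rightarrow> ('e \<Rightarrow> 'b::real_normed_vector) \<Rightarrow> bool" where
  "smooth_on S f \<longleftrightarrow> (\<forall>k. Ck_on k S f)"

type_synonym ('a, 'e) chart = "'a set \<times> ('a \<Rightarrow> 'e)"

definition is_chart :: "('a::topological_space, 'e::euclidean_space) chart \<Rightarrow> bool" where
  "is_chart = (\<lambda>(U, \<psi>).
     open U \<and> open (\<psi> ` U) \<and> homeomorphism U (\<psi> ` U) \<psi> (inv_into U \<psi>))"

definition smooth_compatible ::
  "('a, 'e::euclidean_space) chart \<Rightarrow> ('a, 'e) chart \<Rightarrow> bool" where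
  "smooth_compatible = (\<lambda>(U, \<psi>) (V, \<theta>). smooth_on (\<psi> ` (U \<inter> V)) (\<theta> \<circ> inv_into U \<psi>))"

text \<open>The underlying space is the whole type. Being Hausdorff and second countable is expressed
  by the type classes, and the dimension is that of the model space \<open>'e\<close>.\<close>

definition smooth_manifold ::
  "('a::{t2_space, second_countable_topology}, 'e::euclidean_space) chart set \<Rightarrow> bool" where
  "smooth_manifold A \<longleftrightarrow>
     connected (UNIV :: 'a set) \<and>
     (\<Union>(U, \<psi>)\<in>A. U) = UNIV \<and>
     (\<forall>c\<in>A. is_chart c) \<and>
     (\<forall>c\<in>A. \<forall>d\<in>A. smooth_compatible c d)"

definition smooth_fun :: "('a, 'e::euclidean_space) chart set \<Rightarrow> ('a \<Rightarrow> real) \<Rightarrow> bool" where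
  "smooth_fun A f \<longleftrightarrow> (\<forall>(U, \<psi>)\<in>A. smooth_on (\<psi> ` U) (f \<circ> inv_into U \<psi>))"

section \<open>Vector fields and tensor fields\<close>

text \<open>A tangent vector at \<open>p\<close> is a derivation at \<open>p\<close> of the algebra of smooth functions. It is
  extended by \<open>0\<close> to the non-smooth functions, so that equality of tangent vectors is equality
  of HOL functions.\<close>

type_synonym 'a tangent = "('a \<Rightarrow> real) \<Rightarrow> real"

definition tangent_space ::
  "('a, 'e::euclidean_space) chart set \<Rightarrow> 'a \<Rightarrow> 'a tangent set" where
  "tangent_space A p = {v.
     (\<forall>f. \<not> smooth_fun A f \<longrightarrow> v f = 0) \<and>
     (\<forall>f h. smooth_fun A f \<longrightarrow> smooth_fun A h \<longrightarrow> v (\<lambda>q. f q + h q) = v f + v h) \<and>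
     (\<forall>c f. smooth_fun A f \<longrightarrow> v (\<lambda>q. c * f q) = c * v f) \<and>
     (\<forall>f h. smooth_fun A f \<longrightarrow> smooth_fun A h \<longrightarrow> v (\<lambda>q. f q * h q) = f p * v h + h p * v f)}"

text \<open>For a vector field \<open>X\<close> and a smooth function \<open>f\<close>, the function \<open>X f\<close> is \<open>\<lambda>p. X p f\<close>.\<close>

type_synonym 'a vfield = "'a \<Rightarrow> 'a tangent"

definition vector_fields :: "('a, 'e::euclidean_space) chart set \<Rightarrow> 'a vfield set" where
  "vector_fields A = {X.
     (\<forall>p. X p \<in> tangent_space A p) \<and>
     (\<forall>f. smooth_fun A f \<longrightarrow> smooth_fun A (\<lambda>p. X p f))}"

definition lie_bracket :: "'a vfield \<Rightarrow> 'a vfield \<Rightarrow> 'a vfield" where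
  "lie_bracket X Y = (\<lambda>p f. X p (\<lambda>q. Y q f) - Y p (\<lambda>q. X q f))"

text \<open>A tensor field assigns to each point a multilinear map on the tangent space (its values
  elsewhere are irrelevant). It is smooth if it takes smooth vector fields to smooth functions or
  smooth vector fields.\<close>

definition linear_map_on :: "'v::real_vector set \<Rightarrow> ('v \<Rightarrow> 'w::real_vector) \<Rightarrow> bool" where
  "linear_map_on V h \<longleftrightarrow>
     (\<forall>v\<in>V. \<forall>w\<in>V. h (v + w) = h v + h w) \<and> (\<forall>c. \<forall>v\<in>V. h (c *\<^sub>R v) = c *\<^sub>R h v)"

type_synonym 'a form1 = "'a \<Rightarrow> 'a tangent \<Rightarrow> real"
type_synonym 'a tensor2 = "'a \<Rightarrow> 'a tangent \<Rightarrow> 'a tangent \<Rightarrow> real"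
type_synonym 'a endo = "'a \<Rightarrow> 'a tangent \<Rightarrow> 'a tangent"

definition one_form :: "('a, 'e::euclidean_space) chart set \<Rightarrow> 'a form1 \<Rightarrow> bool" where
  "one_form A \<eta> \<longleftrightarrow>
     (\<forall>p. linear_map_on (tangent_space A p) (\<eta> p)) \<and>
     (\<forall>X\<in>vector_fields A. smooth_fun A (\<lambda>p. \<eta> p (X p)))"

definition endo_field :: "('a, 'e::euclidean_space) chart set \<Rightarrow> 'a endo \<Rightarrow> bool" where
  "endo_field A \<phi> \<longleftrightarrow>
     (\<forall>p. \<phi> p ` tangent_space A p \<subseteq> tangent_space A p \<and> linear_map_on (tangent_space A p) (\<phi> p)) \<and>
     (\<forall>X\<in>vector_fields A. (\<lambda>p. \<phi> p (X p)) \<in> vector_fields A)"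

definition riemannian_metric :: "('a, 'e::euclidean_space) chart set \<Rightarrow> 'a tensor2 \<Rightarrow> bool" where
  "riemannian_metric A g \<longleftrightarrow>
     (\<forall>p. \<forall>v\<in>tangent_space A p. linear_map_on (tangent_space A p) (g p v)) \<and>
     (\<forall>p. \<forall>v\<in>tangent_space A p. \<forall>w\<in>tangent_space A p. g p v w = g p w v) \<and>
     (\<forall>p. \<forall>v\<in>tangent_space A p. v \<noteq> 0 \<longrightarrow> g p v v > 0) \<and>
     (\<forall>X\<in>vector_fields A. \<forall>Y\<in>vector_fields A. smooth_fun A (\<lambda>p. g p (X p) (Y p)))"

section \<open>Exterior calculus\<close>

text \<open>The convention for \<open>d\<close> and \<open>\<wedge>\<close> is the one without numerical factors, that is
  \<open>d\<eta>(X, Y) = X(\<eta>(Y)) - Y(\<eta>(X)) - \<eta>([X, Y])\<close> and \<open>u \<wedge> v = u \<otimes> v - v \<otimes> u\<close> for 1-forms.\<close>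

definition ext_deriv1 :: "'a form1 \<Rightarrow> 'a vfield \<Rightarrow> 'a vfield \<Rightarrow> 'a \<Rightarrow> real" where
  "ext_deriv1 \<eta> X Y p =
     X p (\<lambda>q. \<eta> q (Y q)) - Y p (\<lambda>q. \<eta> q (X q)) - \<eta> p (lie_bracket X Y p)"

definition ext_deriv2 :: "'a tensor2 \<Rightarrow> 'a vfield \<Rightarrow> 'a vfield \<Rightarrow> 'a vfield \<Rightarrow> 'a \<Rightarrow> real" where
  "ext_deriv2 \<omega> X Y Z p =
     X p (\<lambda>q. \<omega> q (Y q) (Z q)) + Y p (\<lambda>q. \<omega> q (Z q) (X q)) + Z p (\<lambda>q. \<omega> q (X q) (Y q))
     - \<omega> p (lie_bracket X Y p) (Z p) - \<omega> p (lie_bracket Y Z p) (X p)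
     - \<omega> p (lie_bracket Z X p) (Y p)"

definition wedge12 ::
  "'a form1 \<Rightarrow> 'a tensor2 \<Rightarrow> 'a \<Rightarrow> 'a tangent \<Rightarrow> 'a tangent \<Rightarrow> 'a tangent \<Rightarrow> real" where
  "wedge12 \<eta> \<omega> p u v w = \<eta> p u * \<omega> p v w + \<eta> p v * \<omega> p w u + \<eta> p w * \<omega> p u v"

section \<open>Connections\<close>

type_synonym 'a connection = "'a vfield \<Rightarrow> 'a vfield \<Rightarrow> 'a vfield"

definition affine_connection ::
  "('a, 'e::euclidean_space) chart set \<Rightarrow> 'a connection \<Rightarrow> bool" where
  "affine_connection A D \<longleftrightarrow>
     (\<forall>X\<in>vector_fields A. \<forall>Y\<in>vector_fields A. D X Y \<in> vector_fields A) \<and>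
     (\<forall>X\<in>vector_fields A. \<forall>X'\<in>vector_fields A. \<forall>Y\<in>vector_fields A.
        D (X + X') Y = D X Y + D X' Y) \<and>
     (\<forall>X\<in>vector_fields A. \<forall>Y\<in>vector_fields A. \<forall>Y'\<in>vector_fields A.
        D X (Y + Y') = D X Y + D X Y') \<and>
     (\<forall>f. smooth_fun A f \<longrightarrow> (\<forall>X\<in>vector_fields A. \<forall>Y\<in>vector_fields A.
        D (\<lambda>p. f p *\<^sub>R X p) Y = (\<lambda>p. f p *\<^sub>R D X Y p) \<and>
        D X (\<lambda>p. f p *\<^sub>R Y p) = (\<lambda>p. X p f *\<^sub>R Y p + f p *\<^sub>R D X Y p)))"

definition cov_form1 :: "'a connection \<Rightarrow> 'a form1 \<Rightarrow> 'a vfield \<Rightarrow> 'a vfield \<Rightarrow> 'a \<Rightarrow> real" where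
  "cov_form1 D \<eta> X Y p = X p (\<lambda>q. \<eta> q (Y q)) - \<eta> p (D X Y p)"

definition cov_tensor2 ::
  "'a connection \<Rightarrow> 'a tensor2 \<Rightarrow> 'a vfield \<Rightarrow> 'a vfield \<Rightarrow> 'a vfield \<Rightarrow> 'a \<Rightarrow> real" where
  "cov_tensor2 D g X Y Z p =
     X p (\<lambda>q. g q (Y q) (Z q)) - g p (D X Y p) (Z p) - g p (Y p) (D X Z p)"

definition cov_endo :: "'a connection \<Rightarrow> 'a endo \<Rightarrow> 'a vfield \<Rightarrow> 'a vfield \<Rightarrow> 'a vfield" where
  "cov_endo D \<phi> X Y = (\<lambda>p. D X (\<lambda>q. \<phi> q (Y q)) p - \<phi> p (D X Y p))"

definition parallel_vfield ::
  "('a, 'e::euclidean_space) chart set \<Rightarrow> 'a connection \<Rightarrow> 'a vfield \<Rightarrow> bool" where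
  "parallel_vfield A D \<xi> \<longleftrightarrow> (\<forall>X\<in>vector_fields A. D X \<xi> = 0)"

definition parallel_form1 ::
  "('a, 'e::euclidean_space) chart set \<Rightarrow> 'a connection \<Rightarrow> 'a form1 \<Rightarrow> bool" where
  "parallel_form1 A D \<eta> \<longleftrightarrow>
     (\<forall>X\<in>vector_fields A. \<forall>Y\<in>vector_fields A. \<forall>p. cov_form1 D \<eta> X Y p = 0)"

definition parallel_tensor2 ::
  "('a, 'e::euclidean_space) chart set \<Rightarrow> 'a connection \<Rightarrow> 'a tensor2 \<Rightarrow> bool" where
  "parallel_tensor2 A D g \<longleftrightarrow>
     (\<forall>X\<in>vector_fields A. \<forall>Y\<in>vector_fields A. \<forall>Z\<in>vector_fields A. \<forall>p.
        cov_tensor2 D g X Y Z p = 0)"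

definition parallel_endo ::
  "('a, 'e::euclidean_space) chart set \<Rightarrow> 'a connection \<Rightarrow> 'a endo \<Rightarrow> bool" where
  "parallel_endo A D \<phi> \<longleftrightarrow>
     (\<forall>X\<in>vector_fields A. \<forall>Y\<in>vector_fields A. cov_endo D \<phi> X Y = 0)"

definition levi_civita ::
  "('a, 'e::euclidean_space) chart set \<Rightarrow> 'a tensor2 \<Rightarrow> 'a connection \<Rightarrow> bool" where
  "levi_civita A g D \<longleftrightarrow>
     affine_connection A D \<and>
     (\<forall>X\<in>vector_fields A. \<forall>Y\<in>vector_fields A. D X Y - D Y X = lie_bracket X Y) \<and>
     parallel_tensor2 A D g"

section \<open>Almost contact metric structures and \<open>SU(2)\<close>-structures\<close>

definition almost_contact_metric ::
  "('a, 'e::euclidean_space) chart set \<Rightarrow>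
     'a endo \<Rightarrow> 'a vfield \<Rightarrow> 'a form1 \<Rightarrow> 'a tensor2 \<Rightarrow> bool" where
  "almost_contact_metric A \<phi> \<xi> \<eta> g \<longleftrightarrow>
     endo_field A \<phi> \<and> \<xi> \<in> vector_fields A \<and> one_form A \<eta> \<and> riemannian_metric A g \<and>
     (\<forall>p. \<forall>v\<in>tangent_space A p. \<phi> p (\<phi> p v) = - v + \<eta> p v *\<^sub>R \<xi> p) \<and>
     (\<forall>p. \<eta> p (\<xi> p) = 1) \<and>
     (\<forall>p. \<forall>v\<in>tangent_space A p. \<forall>w\<in>tangent_space A p.
        g p (\<phi> p v) (\<phi> p w) = g p v w - \<eta> p v * \<eta> p w)"

text \<open>In the following two definitions \<open>D\<close> stands for the Levi-Civita connection of \<open>g\<close>.\<close>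

definition sasakian ::
  "('a, 'e::euclidean_space) chart set \<Rightarrow> 'a connection \<Rightarrow>
     'a endo \<Rightarrow> 'a vfield \<Rightarrow> 'a form1 \<Rightarrow> 'a tensor2 \<Rightarrow> bool" where
  "sasakian A D \<phi> \<xi> \<eta> g \<longleftrightarrow>
     almost_contact_metric A \<phi> \<xi> \<eta> g \<and>
     (\<forall>X\<in>vector_fields A. \<forall>Y\<in>vector_fields A.
        cov_endo D \<phi> X Y = (\<lambda>p. g p (X p) (Y p) *\<^sub>R \<xi> p - \<eta> p (Y p) *\<^sub>R X p))"

definition okumura ::
  "real \<Rightarrow> 'a connection \<Rightarrow>
     'a endo \<Rightarrow> 'a vfield \<Rightarrow> 'a form1 \<Rightarrow> 'a tensor2 \<Rightarrow> 'a connection" where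
  "okumura r D \<phi> \<xi> \<eta> g X Y = (\<lambda>p.
     D X Y p + g p (X p) (\<phi> p (Y p)) *\<^sub>R \<xi> p
     - (r * \<eta> p (X p)) *\<^sub>R \<phi> p (Y p) + \<eta> p (Y p) *\<^sub>R \<phi> p (X p))"

text \<open>The three endomorphism fields are \<open>\<phi> 1\<close>, \<open>\<phi> 2\<close>, \<open>\<phi> 3\<close>; other indices are irrelevant.\<close>

definition su2_structure ::
  "('a, 'e::euclidean_space) chart set \<Rightarrow>
     (nat \<Rightarrow> 'a endo) \<Rightarrow> 'a vfield \<Rightarrow> 'a form1 \<Rightarrow> 'a tensor2 \<Rightarrow> bool" where
  "su2_structure A \<phi> \<xi> \<eta> g \<longleftrightarrow>
     (\<forall>i\<in>{1, 2, 3}. almost_contact_metric A (\<phi> i) \<xi> \<eta> g) \<and>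
     (\<forall>(i, j, k)\<in>{(1, 2, 3), (2, 3, 1), (3, 1, 2)}. \<forall>p. \<forall>v\<in>tangent_space A p.
        \<phi> i p (\<phi> j p v) = \<phi> k p v \<and> \<phi> j p (\<phi> i p v) = - \<phi> k p v)"

definition associated_forms ::
  "('a, 'e::euclidean_space) chart set \<Rightarrow>
     (nat \<Rightarrow> 'a endo) \<Rightarrow> 'a tensor2 \<Rightarrow> (nat \<Rightarrow> 'a tensor2) \<Rightarrow> bool" where
  "associated_forms A \<phi> g \<omega> \<longleftrightarrow>
     (\<forall>i\<in>{1, 2, 3}. \<forall>p. \<forall>v\<in>tangent_space A p. \<forall>w\<in>tangent_space A p.
        \<omega> i p v w = g p (\<phi> i p v) w)"

definition sasaki_einstein ::
  "('a, 'e::euclidean_space) chart set \<Rightarrow> 'a form1 \<Rightarrow> (nat \<Rightarrow> 'a tensor2) \<Rightarrow> bool" where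
  "sasaki_einstein A \<eta> \<omega> \<longleftrightarrow>
     (\<forall>X\<in>vector_fields A. \<forall>Y\<in>vector_fields A. \<forall>p.
        ext_deriv1 \<eta> X Y p = - 2 * \<omega> 3 p (X p) (Y p)) \<and>
     (\<forall>X\<in>vector_fields A. \<forall>Y\<in>vector_fields A. \<forall>Z\<in>vector_fields A. \<forall>p.
        ext_deriv2 (\<omega> 1) X Y Z p = 3 * wedge12 \<eta> (\<omega> 2) p (X p) (Y p) (Z p) \<and>
        ext_deriv2 (\<omega> 2) X Y Z p = - 3 * wedge12 \<eta> (\<omega> 1) p (X p) (Y p) (Z p))"

definition parallelizes_su2 ::
  "('a, 'e::euclidean_space) chart set \<Rightarrow> 'a connection \<Rightarrow>
     (nat \<Rightarrow> 'a endo) \<Rightarrow> 'a vfield \<Rightarrow> 'a form1 \<Rightarrow> 'a tensor2 \<Rightarrow> bool" where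
  "parallelizes_su2 A D \<phi> \<xi> \<eta> g \<longleftrightarrow>
     (\<forall>i\<in>{1, 2, 3}. parallel_endo A D (\<phi> i)) \<and>
     parallel_vfield A D \<xi> \<and> parallel_form1 A D \<eta> \<and> parallel_tensor2 A D g"

end

theory Submission
  imports Defs
begin

text \<open>Write \<open>\<nabla>\<close> for the Levi-Civita connection and \<open>E\<close> for the Okumura connection with \<open>r = 1/2\<close>.
  The structure equations give the Lie derivatives of \<open>\<eta>\<close> and of the \<open>\<omega>\<^sub>i\<close> along \<open>\<xi>\<close>. They imply that
  \<open>\<phi>\<^sub>3\<close>, hence \<open>g\<close>, is invariant under \<open>\<xi>\<close>, so that \<open>\<nabla>\<^sub>X \<xi> = - \<phi>\<^sub>3 X\<close>, and from this \<open>E\<close>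
  parallelizes \<open>\<xi>\<close>, \<open>\<eta>\<close> and \<open>g\<close>. Rewriting \<open>d\<omega>\<^sub>i\<close> in terms of \<open>E\<close>, the torsion contributes exactly
  the right-hand side of the structure equations, so the cyclic sums of \<open>(E\<^sub>X \<omega>\<^sub>i)(Y, Z)\<close> vanish.
  As in Hitchin's lemma on hyper-Kaehler structures, the quaternionic relations then force
  \<open>E \<phi>\<^sub>i = 0\<close>. Read for \<open>i = 3\<close>, this is the Sasakian condition.\<close>

section \<open>Smooth functions and vector fields\<close>

lemma Ck_on_cong:
  assumes "open S" "Ck_on k S f" "\<And>x. x \<in> S \<Longrightarrow> f x = h x"
  shows "Ck_on k S h"
  using assms(2,3)
proof (induction k arbitrary: f h)
  case 0
  then show ?case by (simp cong: continuous_on_cong)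
next
  case (Suc k)
  have der: "(h has_derivative frechet_derivative f (at x)) (at x)" if "x \<in> S" for x
  proof -
    have "(f has_derivative frechet_derivative f (at x)) (at x)"
      using Suc.prems(1) that by (simp flip: frechet_derivative_works)
    then show ?thesis
      using has_derivative_transform_within_open[OF _ assms(1) that] Suc.prems(2) by blast
  qed
  have "Ck_on k S (\<lambda>x. frechet_derivative h (at x) v)" for v
  proof (rule Suc.IH)
    show "Ck_on k S (\<lambda>x. frechet_derivative f (at x) v)"
      using Suc.prems(1) by simp
    show "frechet_derivative f (at x) v = frechet_derivative h (at x) v" if "x \<in> S" for x
      using frechet_derivative_at[OF der[OF that]] by simp
  qed
  then show ?case
    using der by (auto simp: differentiable_def)
qed

text \<open>Each summand of the product rule keeps one factor undifferentiated; its order is lowered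
  here.\<close>

lemma Ck_on_SucD: "Ck_on (Suc k) S f \<Longrightarrow> Ck_on k S f"
proof (induction k arbitrary: f)
  case 0
  then show ?case
    by (auto intro!: continuous_at_imp_continuous_on differentiable_imp_continuous_within)
next
  case (Suc k)
  then show ?case by (auto simp del: Ck_on.simps(1))
qed

lemma Ck_on_const: "Ck_on k S (\<lambda>x. c)"
  by (induction k arbitrary: c) (auto simp: frechet_derivative_const)

lemma Ck_on_add:
  assumes "open S" "Ck_on k S f" "Ck_on k S h"
  shows "Ck_on k S (\<lambda>x. f x + h x)"
  using assms(2,3)
proof (induction k arbitrary: f h)
  case 0
  then show ?case by (simp add: continuous_on_add)
next
  case (Suc k)
  have der: "((\<lambda>x. f x + h x) has_derivative
      (\<lambda>v. frechet_derivative f (at x) v + frechet_derivative h (at x) v)) (at x)"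
    if "x \<in> S" for x
    using Suc.prems that by (intro has_derivative_add) (simp_all flip: frechet_derivative_works)
  have "Ck_on k S (\<lambda>x. frechet_derivative (\<lambda>x. f x + h x) (at x) v)" for v
  \<comment> \<open>The formula for the derivative is known only on \<open>S\<close>, so it is
    substituted by congruence on this open set.\<close>
  proof (rule Ck_on_cong[OF assms(1)])
    show "Ck_on k S (\<lambda>x. frechet_derivative f (at x) v + frechet_derivative h (at x) v)"
      using Suc by simp
    show "frechet_derivative f (at x) v + frechet_derivative h (at x) v
        = frechet_derivative (\<lambda>x. f x + h x) (at x) v" if "x \<in> S" for x
      using frechet_derivative_at[OF der[OF that]] by metis
  qed
  then show ?case using der by (auto simp: differentiable_def)
qed

lemma Ck_on_mult:
  fixes f h :: "'e::real_normed_vector \<Rightarrow> real"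
  assumes "open S" "Ck_on k S f" "Ck_on k S h"
  shows "Ck_on k S (\<lambda>x. f x * h x)"
  using assms(2,3)
proof (induction k arbitrary: f h)
  case 0
  then show ?case by (simp add: continuous_on_mult)
next
  case (Suc k)
  note low = Suc.prems[THEN Ck_on_SucD]
  have der: "((\<lambda>x. f x * h x) has_derivative
      (\<lambda>v. f x * frechet_derivative h (at x) v + frechet_derivative f (at x) v * h x)) (at x)"
    if "x \<in> S" for x
    using Suc.prems that by (intro has_derivative_mult) (simp_all flip: frechet_derivative_works)
  have "Ck_on k S (\<lambda>x. frechet_derivative (\<lambda>x. f x * h x) (at x) v)" for v
  proof (rule Ck_on_cong[OF assms(1)])
    show "Ck_on k S (\<lambda>x. f x * frechet_derivative h (at x) v + frechet_derivative f (at x) v * h x)"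
      using Suc low by (intro Ck_on_add[OF assms(1)]) simp_all
    show "f x * frechet_derivative h (at x) v + frechet_derivative f (at x) v * h x
        = frechet_derivative (\<lambda>x. f x * h x) (at x) v" if "x \<in> S" for x
      using frechet_derivative_at[OF der[OF that]] by metis
  qed
  then show ?case using der by (auto simp: differentiable_def)
qed

section \<open>Derivations, vector fields and the Lie bracket\<close>

locale manifold =
  fixes A :: "('a::{t2_space, second_countable_topology}, 'e::euclidean_space) chart set"
  assumes smooth_manifold: "smooth_manifold A"
begin

abbreviation T :: "'a \<Rightarrow> 'a tangent set" where "T \<equiv> tangent_space A"
abbreviation V :: "'a vfield set" where "V \<equiv> vector_fields A"
abbreviation smooth :: "('a \<Rightarrow> real) \<Rightarrow> bool" where "smooth \<equiv> smooth_fun A"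

lemma chart_image_open: "(U, \<psi>) \<in> A \<Longrightarrow> open (\<psi> ` U)"
  using smooth_manifold by (auto simp: smooth_manifold_def is_chart_def)

lemma smooth_const [simp]: "smooth (\<lambda>p. c)"
  by (auto simp: smooth_fun_def smooth_on_def o_def Ck_on_const)

lemma smooth_add [simp]: "smooth f \<Longrightarrow> smooth h \<Longrightarrow> smooth (\<lambda>p. f p + h p)"
  unfolding smooth_fun_def smooth_on_def o_def
  using Ck_on_add[OF chart_image_open] by fast

lemma smooth_mult [simp]: "smooth f \<Longrightarrow> smooth h \<Longrightarrow> smooth (\<lambda>p. f p * h p)"
  unfolding smooth_fun_def smooth_on_def o_def
  using Ck_on_mult[OF chart_image_open] by fast

lemma smooth_minus [simp]: "smooth f \<Longrightarrow> smooth (\<lambda>p. - f p)"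
  using smooth_mult[of "\<lambda>p. - 1" f] by simp

lemma smooth_diff [simp]: "smooth f \<Longrightarrow> smooth h \<Longrightarrow> smooth (\<lambda>p. f p - h p)"
  using smooth_add[of f "\<lambda>p. - h p"] by simp

lemma smooth_divide [simp]: "smooth f \<Longrightarrow> smooth (\<lambda>p. f p / c)"
  using smooth_mult[of f "\<lambda>p. inverse c"] by (simp add: divide_inverse)

lemma tangent_nonsmooth: "v \<in> T p \<Longrightarrow> \<not> smooth f \<Longrightarrow> v f = 0"
  by (simp add: tangent_space_def)

lemma tangent_deriv_add:
  "v \<in> T p \<Longrightarrow> smooth f \<Longrightarrow> smooth h \<Longrightarrow> v (\<lambda>q. f q + h q) = v f + v h"
  by (simp add: tangent_space_def)

lemma tangent_deriv_scale: "v \<in> T p \<Longrightarrow> smooth f \<Longrightarrow> v (\<lambda>q. c * f q) = c * v f"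
  by (simp add: tangent_space_def)

lemma tangent_deriv_mult:
  "v \<in> T p \<Longrightarrow> smooth f \<Longrightarrow> smooth h \<Longrightarrow> v (\<lambda>q. f q * h q) = f p * v h + h p * v f"
  by (simp add: tangent_space_def)

lemma tangent_deriv_minus: "v \<in> T p \<Longrightarrow> smooth f \<Longrightarrow> v (\<lambda>q. - f q) = - v f"
  using tangent_deriv_scale[of v p f "- 1"] by simp

lemma tangent_deriv_diff:
  "v \<in> T p \<Longrightarrow> smooth f \<Longrightarrow> smooth h \<Longrightarrow> v (\<lambda>q. f q - h q) = v f - v h"
  using tangent_deriv_add[of v p f "\<lambda>q. - h q"] by (simp add: tangent_deriv_minus)

text \<open>The Leibniz rule for \<open>1 * 1\<close> makes \<open>v\<close> vanish at 1; scaling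
  does the rest.\<close>

lemma tangent_deriv_const: "v \<in> T p \<Longrightarrow> v (\<lambda>q. c) = 0"
  using tangent_deriv_mult[of v p "\<lambda>q. 1" "\<lambda>q. 1"] tangent_deriv_scale[of v p "\<lambda>q. 1" c] by simp

lemma tangent_add [simp]: "v \<in> T p \<Longrightarrow> w \<in> T p \<Longrightarrow> v + w \<in> T p"
  by (simp add: tangent_space_def algebra_simps)

lemma tangent_scale [simp]: "v \<in> T p \<Longrightarrow> c *\<^sub>R v \<in> T p"
  by (simp add: tangent_space_def algebra_simps scaleR_fun_def)

lemma tangent_minus [simp]: "v \<in> T p \<Longrightarrow> - v \<in> T p"
  using tangent_scale[of v p "- 1"] by simp

lemma tangent_diff [simp]: "v \<in> T p \<Longrightarrow> w \<in> T p \<Longrightarrow> v - w \<in> T p"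
  using tangent_add[of v p "- w"] by simp

lemma vfield_tangent: "X \<in> V \<Longrightarrow> X p \<in> T p"
  by (simp add: vector_fields_def)

lemma vfield_smooth: "X \<in> V \<Longrightarrow> smooth f \<Longrightarrow> smooth (\<lambda>p. X p f)"
  by (simp add: vector_fields_def)

lemma vfieldI: "(\<And>p. X p \<in> T p) \<Longrightarrow> (\<And>f. smooth f \<Longrightarrow> smooth (\<lambda>p. X p f)) \<Longrightarrow> X \<in> V"
  by (simp add: vector_fields_def)

declare vfield_tangent [simp] vfield_smooth [simp]

lemma vfield_add: "X \<in> V \<Longrightarrow> Y \<in> V \<Longrightarrow> (\<lambda>p. X p + Y p) \<in> V"
  by (rule vfieldI) simp_all

lemma vfield_scale: "X \<in> V \<Longrightarrow> smooth f \<Longrightarrow> (\<lambda>p. f p *\<^sub>R X p) \<in> V"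
  by (rule vfieldI) (simp_all, simp add: scaleR_fun_def)

lemma vfield_minus: "X \<in> V \<Longrightarrow> (\<lambda>p. - X p) \<in> V"
  using vfield_scale[of X "\<lambda>p. - 1"] by simp

lemma vfield_diff: "X \<in> V \<Longrightarrow> Y \<in> V \<Longrightarrow> (\<lambda>p. X p - Y p) \<in> V"
  using vfield_add[of X "\<lambda>p. - Y p"] vfield_minus[of Y] by simp

text \<open>In the Leibniz rule the mixed products of first derivatives are symmetric in
  \<open>X\<close> and \<open>Y\<close> and cancel.\<close>

lemma lie_bracket_vfield [simp]:
  assumes "X \<in> V" "Y \<in> V"
  shows "lie_bracket X Y \<in> V"
proof (rule vfieldI)
  show "lie_bracket X Y p \<in> T p" for p
  proof -
    \<comment> \<open>For non-smooth \<open>f\<close> the inner functions are constantly 0, so the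
      bracket is 0 on \<open>f\<close>, as the encoding of tangent vectors demands.\<close>
    have nonsmooth: "X q f = 0" "Y q f = 0" if "\<not> smooth f" for q f
      using assms that tangent_nonsmooth by (meson vfield_tangent)+
    have X: "\<And>q. X q \<in> T q" and Y: "\<And>q. Y q \<in> T q"
      using assms by simp_all
    show ?thesis
      using assms
      by (auto simp: tangent_space_def[of A p] lie_bracket_def nonsmooth tangent_deriv_const[OF X]
          tangent_deriv_const[OF Y] tangent_deriv_add[OF X] tangent_deriv_add[OF Y]
          tangent_deriv_scale[OF X] tangent_deriv_scale[OF Y]
          tangent_deriv_mult[OF X] tangent_deriv_mult[OF Y] algebra_simps)
  qed
  show "smooth (\<lambda>p. lie_bracket X Y p f)" if "smooth f" for f
    using assms that by (simp add: lie_bracket_def)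
qed

lemma lie_bracket_jacobi:
  assumes "X \<in> V" "Y \<in> V" "Z \<in> V"
  shows "lie_bracket (lie_bracket X Y) Z p + lie_bracket (lie_bracket Y Z) X p
    + lie_bracket (lie_bracket Z X) Y p = 0"
proof
  fix f
  have T: "\<And>q. X q \<in> T q" "\<And>q. Y q \<in> T q" "\<And>q. Z q \<in> T q"
    using assms by simp_all
  show "(lie_bracket (lie_bracket X Y) Z p + lie_bracket (lie_bracket Y Z) X p
    + lie_bracket (lie_bracket Z X) Y p) f = 0 f"
  proof (cases "smooth f")
    case True
    then show ?thesis
      using assms by (simp add: lie_bracket_def T[THEN tangent_deriv_diff])
  next
    case False
    have "lie_bracket X' Y' p f = 0" if "X' \<in> V" "Y' \<in> V" for X' Y'
      using that False tangent_nonsmooth[OF vfield_tangent[OF lie_bracket_vfield]] by blast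
    with assms show ?thesis by simp
  qed
qed

end

context manifold
begin

lemma lie_bracket_commute: "lie_bracket X Y p = - lie_bracket Y X p"
  by (simp add: lie_bracket_def fun_eq_iff)

text \<open>This is \<open>d d = 0\<close>: iterated derivatives cancel in the cyclic sum, and the
  double brackets vanish by Jacobi. The factor \<open>c\<close> serves the equation for
  \<open>d\<eta>\<close>.\<close>

lemma ext_deriv2_ext_deriv1:
  assumes "one_form A \<eta>" and XYZ: "X \<in> V" "Y \<in> V" "Z \<in> V"
    and \<omega>: "\<And>X Y p. X \<in> V \<Longrightarrow> Y \<in> V \<Longrightarrow> \<omega> p (X p) (Y p) = c * ext_deriv1 \<eta> X Y p"
  shows "ext_deriv2 \<omega> X Y Z p = 0"
proof -
  have [simp]: "smooth (\<lambda>q. \<eta> q (X q))" if "X \<in> V" for X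
    using assms(1) that by (simp add: one_form_def)
  have add: "\<eta> p (v + w) = \<eta> p v + \<eta> p w" if "v \<in> T p" "w \<in> T p" for v w
    using assms(1) that by (simp add: one_form_def linear_map_on_def)
  have "\<eta> p (0 *\<^sub>R X p) = 0 *\<^sub>R \<eta> p (X p)"
    using assms(1) XYZ(1) unfolding one_form_def linear_map_on_def by (metis vfield_tangent)
  then have zero: "\<eta> p 0 = 0" by simp
  have deriv: "W p (\<lambda>q. \<omega> q (X q) (Y q)) =
      c * (W p (\<lambda>q. X q (\<lambda>r. \<eta> r (Y r))) - W p (\<lambda>q. Y q (\<lambda>r. \<eta> r (X r)))
        - W p (\<lambda>q. \<eta> q (lie_bracket X Y q)))"
    if "W \<in> V" "X \<in> V" "Y \<in> V" for W X Y
    using that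
    by (simp add: \<omega> ext_deriv1_def tangent_deriv_scale[OF vfield_tangent[OF that(1)]]
        tangent_deriv_diff[OF vfield_tangent[OF that(1)]])
  have bracket: "\<omega> p (lie_bracket X Y p) (W p) =
      c * (X p (\<lambda>q. Y q (\<lambda>r. \<eta> r (W r))) - Y p (\<lambda>q. X q (\<lambda>r. \<eta> r (W r)))
        - W p (\<lambda>q. \<eta> q (lie_bracket X Y q)) - \<eta> p (lie_bracket (lie_bracket X Y) W p))"
    if "W \<in> V" "X \<in> V" "Y \<in> V" for W X Y
    using that by (simp add: \<omega> ext_deriv1_def) (simp add: lie_bracket_def)
  have "\<eta> p (lie_bracket (lie_bracket X Y) Z p) + \<eta> p (lie_bracket (lie_bracket Y Z) X p)
      + \<eta> p (lie_bracket (lie_bracket Z X) Y p) = 0"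
    using arg_cong[OF lie_bracket_jacobi[OF XYZ, of p], of "\<eta> p"] XYZ by (simp add: add zero)
  then have "c * (\<eta> p (lie_bracket (lie_bracket X Y) Z p) + \<eta> p (lie_bracket (lie_bracket Y Z) X p)
      + \<eta> p (lie_bracket (lie_bracket Z X) Y p)) = 0" by simp
  then show ?thesis
    using XYZ by (simp add: ext_deriv2_def deriv bracket algebra_simps)
qed

end

section \<open>Almost contact metric structures\<close>

locale almost_contact = manifold A
  for A :: "('a::{t2_space, second_countable_topology}, 'e::euclidean_space) chart set" +
  fixes \<phi> :: "'a endo" and \<xi> :: "'a vfield" and \<eta> :: "'a form1" and g :: "'a tensor2"
  assumes almost_contact_metric: "almost_contact_metric A \<phi> \<xi> \<eta> g"
begin

lemma xi_vfield [simp]: "\<xi> \<in> V"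
  and one_form: "one_form A \<eta>"
  and phi_phi [simp]: "v \<in> T p \<Longrightarrow> \<phi> p (\<phi> p v) = - v + \<eta> p v *\<^sub>R \<xi> p"
  and eta_xi [simp]: "\<eta> p (\<xi> p) = 1"
  and g_phi_phi: "v \<in> T p \<Longrightarrow> w \<in> T p \<Longrightarrow> g p (\<phi> p v) (\<phi> p w) = g p v w - \<eta> p v * \<eta> p w"
  using almost_contact_metric by (simp_all add: almost_contact_metric_def)

lemma phi_tangent [simp]: "v \<in> T p \<Longrightarrow> \<phi> p v \<in> T p"
  and phi_add [simp]: "v \<in> T p \<Longrightarrow> w \<in> T p \<Longrightarrow> \<phi> p (v + w) = \<phi> p v + \<phi> p w"
  and phi_scale [simp]: "v \<in> T p \<Longrightarrow> \<phi> p (c *\<^sub>R v) = c *\<^sub>R \<phi> p v"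
  and phi_vfield [simp]: "X \<in> V \<Longrightarrow> (\<lambda>p. \<phi> p (X p)) \<in> V"
  using almost_contact_metric
  unfolding almost_contact_metric_def endo_field_def linear_map_on_def by blast+

lemma eta_add [simp]: "v \<in> T p \<Longrightarrow> w \<in> T p \<Longrightarrow> \<eta> p (v + w) = \<eta> p v + \<eta> p w"
  and eta_scale [simp]: "v \<in> T p \<Longrightarrow> \<eta> p (c *\<^sub>R v) = c * \<eta> p v"
  and eta_smooth [simp]: "X \<in> V \<Longrightarrow> smooth (\<lambda>p. \<eta> p (X p))"
  using one_form by (auto simp: one_form_def linear_map_on_def)

lemma g_add_right [simp]:
    "u \<in> T p \<Longrightarrow> v \<in> T p \<Longrightarrow> w \<in> T p \<Longrightarrow> g p u (v + w) = g p u v + g p u w"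
  and g_scale_right [simp]: "v \<in> T p \<Longrightarrow> w \<in> T p \<Longrightarrow> g p v (c *\<^sub>R w) = c * g p v w"
  and g_commute: "v \<in> T p \<Longrightarrow> w \<in> T p \<Longrightarrow> g p v w = g p w v"
  and g_positive: "v \<in> T p \<Longrightarrow> v \<noteq> 0 \<Longrightarrow> g p v v > 0"
  and g_smooth [simp]: "X \<in> V \<Longrightarrow> Y \<in> V \<Longrightarrow> smooth (\<lambda>p. g p (X p) (Y p))"
  using almost_contact_metric
  by (auto simp: almost_contact_metric_def riemannian_metric_def linear_map_on_def)

lemma g_add_left [simp]:
    "u \<in> T p \<Longrightarrow> v \<in> T p \<Longrightarrow> w \<in> T p \<Longrightarrow> g p (u + v) w = g p u w + g p v w"
  and g_scale_left [simp]: "v \<in> T p \<Longrightarrow> w \<in> T p \<Longrightarrow> g p (c *\<^sub>R v) w = c * g p v w"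
  by (simp_all add: g_commute[of _ p w])

lemma tangent_zero [simp]: "0 \<in> T p"
  using tangent_scale[of "\<xi> p" p 0] by simp

lemma phi_minus [simp]: "v \<in> T p \<Longrightarrow> \<phi> p (- v) = - \<phi> p v"
  and eta_minus [simp]: "v \<in> T p \<Longrightarrow> \<eta> p (- v) = - \<eta> p v"
  and g_minus_right [simp]: "v \<in> T p \<Longrightarrow> w \<in> T p \<Longrightarrow> g p v (- w) = - g p v w"
  and g_minus_left [simp]: "v \<in> T p \<Longrightarrow> w \<in> T p \<Longrightarrow> g p (- v) w = - g p v w"
  using phi_scale[of v p "- 1"] eta_scale[of v p "- 1"] g_scale_right[of v p w "- 1"]
    g_scale_left[of v p w "- 1"] by simp_all

lemma phi_diff [simp]: "v \<in> T p \<Longrightarrow> w \<in> T p \<Longrightarrow> \<phi> p (v - w) = \<phi> p v - \<phi> p w"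
  and eta_diff [simp]: "v \<in> T p \<Longrightarrow> w \<in> T p \<Longrightarrow> \<eta> p (v - w) = \<eta> p v - \<eta> p w"
  and g_diff_right [simp]:
    "u \<in> T p \<Longrightarrow> v \<in> T p \<Longrightarrow> w \<in> T p \<Longrightarrow> g p u (v - w) = g p u v - g p u w"
  and g_diff_left [simp]:
    "u \<in> T p \<Longrightarrow> v \<in> T p \<Longrightarrow> w \<in> T p \<Longrightarrow> g p (u - v) w = g p u w - g p v w"
  using phi_add[of v p "- w"] eta_add[of v p "- w"] g_add_right[of u p v "- w"]
    g_add_left[of u p "- v" w] by simp_all

lemma phi_zero [simp]: "\<phi> p 0 = 0"
  and eta_zero [simp]: "\<eta> p 0 = 0"
  and g_zero_right [simp]: "v \<in> T p \<Longrightarrow> g p v 0 = 0"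
  and g_zero_left [simp]: "v \<in> T p \<Longrightarrow> g p 0 v = 0"
  using phi_scale[of 0 p 0] eta_scale[of 0 p 0] g_scale_right[of v p 0 0] g_scale_left[of 0 p v 0]
  by simp_all

text \<open>Pairing \<open>X\<close> with itself suffices, so no tangent vector has to be extended
  to a global field.\<close>

lemma vfield_eq_zeroI:
  assumes "X \<in> V" "\<And>Y. Y \<in> V \<Longrightarrow> g p (X p) (Y p) = 0"
  shows "X p = 0"
  using g_positive[of "X p" p] assms by (metis less_irrefl vfield_tangent)

lemma xi_nonzero [simp]: "\<xi> p \<noteq> 0"
  using eta_xi[of p] eta_zero[of p] by (metis zero_neq_one)

text \<open>\<open>\<phi>\<close> squared kills \<open>\<xi>\<close>, so the cube at
  \<open>\<xi>\<close> shows that \<open>\<phi> \<xi> = c \<xi>\<close>; squaring again gives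
  \<open>c = 0\<close>.\<close>

lemma phi_xi [simp]: "\<phi> p (\<xi> p) = 0"
proof -
  define c where "c = \<eta> p (\<phi> p (\<xi> p))"
  have sq: "\<phi> p (\<phi> p (\<xi> p)) = 0" by simp
  have "\<phi> p (\<phi> p (\<phi> p (\<xi> p))) = - \<phi> p (\<xi> p) + c *\<^sub>R \<xi> p"
    unfolding c_def by (rule phi_phi) simp
  then have eq: "\<phi> p (\<xi> p) = c *\<^sub>R \<xi> p" by (simp only: sq) (simp add: add_eq_0_iff)
  have "\<phi> p (c *\<^sub>R \<xi> p) = c *\<^sub>R (c *\<^sub>R \<xi> p)"
    using eq phi_scale[of "\<xi> p" p c] by simp
  then have "\<eta> p (c *\<^sub>R (c *\<^sub>R \<xi> p)) = 0" using sq eq by simp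
  then have "c = 0" by (simp del: scaleR_scaleR)
  with eq show ?thesis by simp
qed

text \<open>The two ways of bracketing the cube of \<open>\<phi>\<close> differ by
  \<open>\<eta>(\<phi> v) \<xi>\<close>.\<close>

lemma eta_phi [simp]:
  assumes "v \<in> T p" shows "\<eta> p (\<phi> p v) = 0"
proof -
  have "\<phi> p (\<phi> p (\<phi> p v)) = - \<phi> p v + \<eta> p (\<phi> p v) *\<^sub>R \<xi> p"
    using assms by (intro phi_phi) simp
  moreover have "\<phi> p (\<phi> p (\<phi> p v)) = \<phi> p (- v + \<eta> p v *\<^sub>R \<xi> p)"
    using assms by (subst phi_phi) simp_all
  ultimately have "\<eta> p (\<phi> p v) *\<^sub>R \<xi> p = 0" using assms by simp
  then have "\<eta> p (\<eta> p (\<phi> p v) *\<^sub>R \<xi> p) = 0" by simp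
  then show ?thesis by simp
qed

lemma g_xi_right [simp]: "v \<in> T p \<Longrightarrow> g p v (\<xi> p) = \<eta> p v"
  using g_phi_phi[of v p "\<xi> p"] by simp

lemma g_xi_left [simp]: "v \<in> T p \<Longrightarrow> g p (\<xi> p) v = \<eta> p v"
  using g_commute[of v p "\<xi> p"] by simp

lemma g_phi_right: "v \<in> T p \<Longrightarrow> w \<in> T p \<Longrightarrow> g p v (\<phi> p w) = - g p (\<phi> p v) w"
  using g_phi_phi[of "\<phi> p v" p w] by simp

lemma omega_skew: "v \<in> T p \<Longrightarrow> w \<in> T p \<Longrightarrow> g p (\<phi> p v) w = - g p (\<phi> p w) v"
  using g_phi_right[of w p v] g_commute[of "\<phi> p v" p w] by simp

text \<open>Cartan's formula: contraction of the 2-form with \<open>\<xi>\<close> is 0, so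
  contracting its differential gives its Lie derivative along \<open>\<xi>\<close>.\<close>

lemma ext_deriv2_xi:
  assumes "X \<in> V" "Y \<in> V"
  shows "ext_deriv2 (\<lambda>q v w. g q (\<phi> q v) w) \<xi> X Y p =
    \<xi> p (\<lambda>q. g q (\<phi> q (X q)) (Y q))
    - g p (\<phi> p (lie_bracket \<xi> X p)) (Y p) - g p (\<phi> p (X p)) (lie_bracket \<xi> Y p)"
proof -
  have "g p (\<phi> p (lie_bracket Y \<xi> p)) (X p) = g p (\<phi> p (X p)) (lie_bracket \<xi> Y p)"
    using assms g_phi_right[of "X p" p "lie_bracket \<xi> Y p"] lie_bracket_commute[of Y \<xi> p]
      g_commute[of "X p" p "\<phi> p (lie_bracket \<xi> Y p)"] by simp
  then show ?thesis
    using assms by (simp add: ext_deriv2_def tangent_deriv_const[OF vfield_tangent])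
qed

end

section \<open>SU(2)-structures\<close>

text \<open>The unprefixed facts belong to \<open>\<phi>3\<close>, the structure that defines the
  Okumura connection.\<close>

locale su2 = almost_contact A \<phi>3 \<xi> \<eta> g + J1: almost_contact A \<phi>1 \<xi> \<eta> g +
  J2: almost_contact A \<phi>2 \<xi> \<eta> g
  for A :: "('a::{t2_space, second_countable_topology}, 'e::euclidean_space) chart set"
    and \<phi>1 \<phi>2 \<phi>3 \<xi> \<eta> g +
  assumes phi12 [simp]: "v \<in> T p \<Longrightarrow> \<phi>1 p (\<phi>2 p v) = \<phi>3 p v"
    and phi21 [simp]: "v \<in> T p \<Longrightarrow> \<phi>2 p (\<phi>1 p v) = - \<phi>3 p v"
    and phi23 [simp]: "v \<in> T p \<Longrightarrow> \<phi>2 p (\<phi>3 p v) = \<phi>1 p v"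
    and phi32 [simp]: "v \<in> T p \<Longrightarrow> \<phi>3 p (\<phi>2 p v) = - \<phi>1 p v"
    and phi31 [simp]: "v \<in> T p \<Longrightarrow> \<phi>3 p (\<phi>1 p v) = \<phi>2 p v"
    and phi13 [simp]: "v \<in> T p \<Longrightarrow> \<phi>1 p (\<phi>3 p v) = - \<phi>2 p v"

locale sasaki_einstein_su2 = su2 A \<phi>1 \<phi>2 \<phi>3 \<xi> \<eta> g
  for A :: "('a::{t2_space, second_countable_topology}, 'e::euclidean_space) chart set"
    and \<phi>1 \<phi>2 \<phi>3 \<xi> \<eta> g +
  fixes D :: "'a connection"
  assumes levi_civita: "levi_civita A g D"
    and d_eta: "X \<in> V \<Longrightarrow> Y \<in> V \<Longrightarrow> ext_deriv1 \<eta> X Y p = - 2 * g p (\<phi>3 p (X p)) (Y p)"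
    and d_omega1: "X \<in> V \<Longrightarrow> Y \<in> V \<Longrightarrow> Z \<in> V \<Longrightarrow>
      ext_deriv2 (\<lambda>q v w. g q (\<phi>1 q v) w) X Y Z p
        = 3 * wedge12 \<eta> (\<lambda>q v w. g q (\<phi>2 q v) w) p (X p) (Y p) (Z p)"
    and d_omega2: "X \<in> V \<Longrightarrow> Y \<in> V \<Longrightarrow> Z \<in> V \<Longrightarrow>
      ext_deriv2 (\<lambda>q v w. g q (\<phi>2 q v) w) X Y Z p
        = - 3 * wedge12 \<eta> (\<lambda>q v w. g q (\<phi>1 q v) w) p (X p) (Y p) (Z p)"
begin

lemma d_omega3:
  "X \<in> V \<Longrightarrow> Y \<in> V \<Longrightarrow> Z \<in> V \<Longrightarrow> ext_deriv2 (\<lambda>q v w. g q (\<phi>3 q v) w) X Y Z p = 0"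
  by (rule ext_deriv2_ext_deriv1[OF one_form, where c = "- 1 / 2"]) (simp_all add: d_eta)

section \<open>Lie derivatives along the Reeb field\<close>

abbreviation L :: "'a vfield \<Rightarrow> 'a vfield" where "L \<equiv> lie_bracket \<xi>"

text \<open>Contracting the structure equation with \<open>\<xi>\<close> leaves only
  \<open>3 \<omega>\<^sub>2\<close>, as \<open>\<xi>\<close> is in the kernel of
  \<open>\<omega>\<^sub>2\<close>. The next lemmas are analogous.\<close>

lemma lie_xi_omega1:
  "X \<in> V \<Longrightarrow> Y \<in> V \<Longrightarrow> \<xi> p (\<lambda>q. g q (\<phi>1 q (X q)) (Y q)) =
    g p (\<phi>1 p (L X p)) (Y p) + g p (\<phi>1 p (X p)) (L Y p) + 3 * g p (\<phi>2 p (X p)) (Y p)"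
  using d_omega1[of \<xi> X Y p] by (simp add: J1.ext_deriv2_xi wedge12_def)

lemma lie_xi_omega2:
  "X \<in> V \<Longrightarrow> Y \<in> V \<Longrightarrow> \<xi> p (\<lambda>q. g q (\<phi>2 q (X q)) (Y q)) =
    g p (\<phi>2 p (L X p)) (Y p) + g p (\<phi>2 p (X p)) (L Y p) - 3 * g p (\<phi>1 p (X p)) (Y p)"
  using d_omega2[of \<xi> X Y p] by (simp add: J2.ext_deriv2_xi wedge12_def)

lemma lie_xi_omega3:
  "X \<in> V \<Longrightarrow> Y \<in> V \<Longrightarrow> \<xi> p (\<lambda>q. g q (\<phi>3 q (X q)) (Y q)) =
    g p (\<phi>3 p (L X p)) (Y p) + g p (\<phi>3 p (X p)) (L Y p)"
  using d_omega3[of \<xi> X Y p] by (simp add: ext_deriv2_xi)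

lemma lie_xi_eta: "X \<in> V \<Longrightarrow> \<xi> p (\<lambda>q. \<eta> q (X q)) = \<eta> p (L X p)"
  using d_eta[of \<xi> X p] by (simp add: ext_deriv1_def tangent_deriv_const[OF vfield_tangent])

text \<open>Since \<open>\<omega>\<^sub>2 = - \<omega>\<^sub>1(\<phi>\<^sub>3 \<cdot>, \<cdot>)\<close>, the Lie derivatives of \<open>\<omega>\<^sub>1\<close> and \<open>\<omega>\<^sub>2\<close> determine that
  of \<open>\<phi>\<^sub>3\<close>.\<close>

lemma lie_xi_phi3:
  assumes X: "X \<in> V"
  shows "L (\<lambda>q. \<phi>3 q (X q)) p = \<phi>3 p (L X p)"
proof -
  define X3 where "X3 = (\<lambda>q. \<phi>3 q (X q))"
  have X3 [simp]: "X3 \<in> V" using X by (simp add: X3_def)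
  define W where "W = (\<lambda>q. L X3 q - \<phi>3 q (L X q))"
  have W: "W \<in> V" using X by (simp add: W_def vfield_diff)
  \<comment> \<open>Both sides of \<open>\<xi>(\<omega>\<^sub>1(\<phi>3 X, Y)) = -
    \<xi>(\<omega>\<^sub>2(X, Y))\<close> are expanded; the terms in \<open>L Y\<close> and
    \<open>3 \<omega>\<^sub>1(X, Y)\<close> cancel.\<close>
  have "g p (\<phi>1 p (W p)) (Y p) = 0" if "Y \<in> V" for Y
    using X that lie_xi_omega1[OF X3 that, of p] lie_xi_omega2[OF X that, of p]
    by (simp add: X3_def[THEN fun_cong] W_def tangent_deriv_minus[OF vfield_tangent[OF xi_vfield]])
  then have "\<phi>1 p (W p) = 0"
    using vfield_eq_zeroI[of "\<lambda>q. \<phi>1 q (W q)" p] W by simp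
  \<comment> \<open>This leaves only a multiple of \<open>\<xi>\<close> in \<open>W\<close>, which
    invariance of \<open>\<eta>\<close> excludes.\<close>
  then have "\<phi>1 p (\<phi>1 p (W p)) = 0" by simp
  moreover have "\<eta> p (W p) = 0"
    using X lie_xi_eta[OF X3, of p]
    by (simp add: W_def X3_def[THEN fun_cong] tangent_deriv_const[OF vfield_tangent[OF xi_vfield]])
  ultimately have "W p = 0" using W by simp
  then show ?thesis by (simp add: W_def X3_def)
qed

text \<open>The metric is \<open>\<omega>\<^sub>3(X, \<phi>3 Y) + \<eta>(X) \<eta>(Y)\<close>, built
  from invariant tensors.\<close>

lemma lie_xi_metric:
  assumes X: "X \<in> V" and Y: "Y \<in> V"
  shows "\<xi> p (\<lambda>q. g q (X q) (Y q)) = g p (L X p) (Y p) + g p (X p) (L Y p)"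
proof -
  define Y3 where "Y3 = (\<lambda>q. \<phi>3 q (Y q))"
  have Y3 [simp]: "Y3 \<in> V" using Y by (simp add: Y3_def)
  have "\<xi> p (\<lambda>q. g q (X q) (Y q))
      = \<xi> p (\<lambda>q. g q (\<phi>3 q (X q)) (Y3 q) + \<eta> q (X q) * \<eta> q (Y q))"
    using X Y by (simp add: Y3_def g_phi_phi)
  also have "\<dots> = \<xi> p (\<lambda>q. g q (\<phi>3 q (X q)) (Y3 q))
      + (\<eta> p (X p) * \<xi> p (\<lambda>q. \<eta> q (Y q)) + \<eta> p (Y p) * \<xi> p (\<lambda>q. \<eta> q (X q)))"
    using X Y by (simp add: tangent_deriv_add[OF vfield_tangent[OF xi_vfield]]
        tangent_deriv_mult[OF vfield_tangent[OF xi_vfield]])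
  also have "\<dots> = g p (\<phi>3 p (L X p)) (\<phi>3 p (Y p)) + g p (\<phi>3 p (X p)) (\<phi>3 p (L Y p))
      + (\<eta> p (X p) * \<eta> p (L Y p) + \<eta> p (Y p) * \<eta> p (L X p))"
    using X Y lie_xi_omega3[OF X Y3, of p] lie_xi_phi3[OF Y, of p]
    by (simp add: lie_xi_eta Y3_def)
  also have "\<dots> = g p (L X p) (Y p) + g p (X p) (L Y p)"
    using X Y by (simp add: g_phi_phi)
  finally show ?thesis .
qed

section \<open>The Levi-Civita connection and the derivative of the Reeb field\<close>

lemma D_vfield [simp]: "X \<in> V \<Longrightarrow> Y \<in> V \<Longrightarrow> D X Y \<in> V"
  using levi_civita unfolding levi_civita_def affine_connection_def by blast

lemma D_add:
  assumes "X \<in> V" "Y \<in> V" "Z \<in> V"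
  shows "D X (\<lambda>q. Y q + Z q) p = D X Y p + D X Z p"
proof -
  have "D X (Y + Z) = D X Y + D X Z"
    using levi_civita assms unfolding levi_civita_def affine_connection_def by blast
  then show ?thesis by (simp add: func_plus)
qed

lemma D_scale:
  assumes "smooth f" "X \<in> V" "Y \<in> V"
  shows "D X (\<lambda>q. f q *\<^sub>R Y q) p = X p f *\<^sub>R Y p + f p *\<^sub>R D X Y p"
proof -
  have "D X (\<lambda>q. f q *\<^sub>R Y q) = (\<lambda>q. X q f *\<^sub>R Y q + f q *\<^sub>R D X Y q)"
    using levi_civita assms unfolding levi_civita_def affine_connection_def by blast
  then show ?thesis by simp
qed

lemma D_metric:
  assumes "X \<in> V" "Y \<in> V" "Z \<in> V"
  shows "X p (\<lambda>q. g q (Y q) (Z q)) = g p (D X Y p) (Z p) + g p (Y p) (D X Z p)"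
proof -
  have "cov_tensor2 D g X Y Z p = 0"
    using levi_civita assms unfolding levi_civita_def parallel_tensor2_def by blast
  then show ?thesis by (simp add: cov_tensor2_def)
qed

lemma D_torsion_free: "X \<in> V \<Longrightarrow> Y \<in> V \<Longrightarrow> lie_bracket X Y p = D X Y p - D Y X p"
  using levi_civita unfolding levi_civita_def by (metis minus_apply)

lemma D_diff:
  assumes "X \<in> V" "Y \<in> V" "Z \<in> V"
  shows "D X (\<lambda>q. Y q - Z q) p = D X Y p - D X Z p"
proof -
  have "D X (\<lambda>q. - Z q) p = - D X Z p"
    using D_scale[of "\<lambda>q. - 1" X Z p] assms
    by (simp add: tangent_deriv_const[OF vfield_tangent[OF assms(1)]])
  then show ?thesis
    using D_add[OF assms(1,2) vfield_minus[OF assms(3)], of p] by simp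
qed

text \<open>The metric is invariant under \<open>\<xi>\<close>, so that the symmetric part of \<open>D \<xi>\<close> vanishes; its skew
  part is given by \<open>d\<eta>\<close>.\<close>

lemma D_xi:
  assumes X: "X \<in> V"
  shows "D X \<xi> p = - \<phi>3 p (X p)"
proof -
  define W where "W = (\<lambda>q. D X \<xi> q + \<phi>3 q (X q))"
  have W: "W \<in> V" using X by (simp add: W_def vfield_add)
  have "g p (W p) (Y p) = 0" if Y: "Y \<in> V" for Y
  proof -
    have eta: "Z p (\<lambda>q. \<eta> q (Y q)) = g p (D Z \<xi> p) (Y p) + \<eta> p (D Z Y p)"
      if "Z \<in> V" "Y \<in> V" for Z Y
      using D_metric[OF that(1) xi_vfield that(2), of p] that by simp
    have "g p (D X \<xi> p) (Y p) - g p (D Y \<xi> p) (X p) = - 2 * g p (\<phi>3 p (X p)) (Y p)"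
      using X Y d_eta[OF X Y, of p] by (simp add: ext_deriv1_def eta D_torsion_free)
    \<comment> \<open>Killing equation: the Lie and covariant derivatives of \<open>g\<close> along
      \<open>\<xi>\<close> are compared.\<close>
    moreover have "g p (D X \<xi> p) (Y p) + g p (D Y \<xi> p) (X p) = 0"
      using X Y lie_xi_metric[OF X Y, of p] D_metric[OF xi_vfield X Y, of p]
        g_commute[of "X p" p "D Y \<xi> p"]
      by (simp add: D_torsion_free)
    ultimately show ?thesis using X Y by (simp add: W_def)
  qed
  then have "W p = 0" using vfield_eq_zeroI W by blast
  then show ?thesis by (simp add: W_def add_eq_0_iff)
qed

end

section \<open>Hitchin's lemma\<close>

text \<open>An algebraic form of the fact that closed forms \<open>\<omega>\<^sub>1, \<omega>\<^sub>2, \<omega>\<^sub>3\<close> belonging to an almost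
  hyper-Hermitian structure are parallel. Here \<open>B\<^sub>i x y z\<close> plays the role of
  \<open>g ((\<nabla>\<^sub>x \<phi>\<^sub>i) y) z\<close>. Closedness of \<open>\<omega>\<^sub>1\<close> and \<open>\<omega>\<^sub>2\<close> makes the Nijenhuis tensor of \<open>\<phi>\<^sub>3\<close> vanish, and
  then closedness of \<open>\<omega>\<^sub>3\<close> is the Kaehler condition.\<close>

lemma hitchin_algebra:
  fixes B1 B2 B3 :: "'v \<Rightarrow> 'v \<Rightarrow> 'v \<Rightarrow> real"
  assumes closed: "\<And>x. x \<in> S \<Longrightarrow> f1 x \<in> S" "\<And>x. x \<in> S \<Longrightarrow> f2 x \<in> S" "\<And>x. x \<in> S \<Longrightarrow> f3 x \<in> S"
    and skew: "\<And>x y z. x \<in> S \<Longrightarrow> y \<in> S \<Longrightarrow> z \<in> S \<Longrightarrow> B1 x y z = - B1 x z y"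
      "\<And>x y z. x \<in> S \<Longrightarrow> y \<in> S \<Longrightarrow> z \<in> S \<Longrightarrow> B2 x y z = - B2 x z y"
      "\<And>x y z. x \<in> S \<Longrightarrow> y \<in> S \<Longrightarrow> z \<in> S \<Longrightarrow> B3 x y z = - B3 x z y"
    and cyclic: "\<And>x y z. x \<in> S \<Longrightarrow> y \<in> S \<Longrightarrow> z \<in> S \<Longrightarrow> B1 x y z + B1 y z x + B1 z x y = 0"
      "\<And>x y z. x \<in> S \<Longrightarrow> y \<in> S \<Longrightarrow> z \<in> S \<Longrightarrow> B2 x y z + B2 y z x + B2 z x y = 0"
      "\<And>x y z. x \<in> S \<Longrightarrow> y \<in> S \<Longrightarrow> z \<in> S \<Longrightarrow> B3 x y z + B3 y z x + B3 z x y = 0"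
    and B1: "\<And>x y z. x \<in> S \<Longrightarrow> y \<in> S \<Longrightarrow> z \<in> S \<Longrightarrow> B1 x y z = B2 x (f3 y) z - B3 x y (f2 z)"
    and B2: "\<And>x y z. x \<in> S \<Longrightarrow> y \<in> S \<Longrightarrow> z \<in> S \<Longrightarrow> B2 x y z = B3 x (f1 y) z - B1 x y (f3 z)"
    and sq: "\<And>x y z. x \<in> S \<Longrightarrow> y \<in> S \<Longrightarrow> z \<in> S \<Longrightarrow> B2 x y (f3 (f3 z)) = - B2 x y z"
      "\<And>x y z. x \<in> S \<Longrightarrow> y \<in> S \<Longrightarrow> z \<in> S \<Longrightarrow> B3 x y (f2 (f2 z)) = - B3 x y z"
      "\<And>x y z. x \<in> S \<Longrightarrow> y \<in> S \<Longrightarrow> z \<in> S \<Longrightarrow> B3 x y (f3 (f3 z)) = - B3 x y z"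
    and f23: "\<And>x. x \<in> S \<Longrightarrow> f2 (f3 x) = f1 x"
    and comm: "\<And>x y z. x \<in> S \<Longrightarrow> y \<in> S \<Longrightarrow> z \<in> S \<Longrightarrow> B3 x (f3 y) z = B3 x y (f3 z)"
    and xyz: "x \<in> S" "y \<in> S" "z \<in> S"
  shows "B3 x y z = 0"
proof -
  \<comment> \<open>The Nijenhuis tensor of \<open>f3\<close> in terms of the covariant derivative,
    paired with \<open>z\<close>.\<close>
  define N where "N x y z = B3 (f3 x) y z - B3 (f3 y) x z + B3 x (f3 y) z - B3 y (f3 x) z" for x y z
  have N_f2: "N x y (f2 z) = 0" if S: "x \<in> S" "y \<in> S" "z \<in> S" for x y z
  proof -
    note S' = S S[THEN closed(1)] S[THEN closed(3)]
    have "B2 x (f3 (f3 y)) z = - B2 x y z" "B2 y (f3 (f3 x)) z = - B2 y x z"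
      using S' sq(1)[of x z y] sq(1)[of y z x] skew(2)[of x "f3 (f3 y)" z]
        skew(2)[of y "f3 (f3 x)" z] skew(2)[of x y z] skew(2)[of y x z] closed(3) by auto
    then have "N x y (f2 z) =
        B2 (f3 x) (f3 y) z - B1 (f3 x) y z - B2 (f3 y) (f3 x) z + B1 (f3 y) x z
        - B2 x y z - B1 x (f3 y) z + B2 y x z + B1 y (f3 x) z"
      using S' B1[of "f3 x" y z] B1[of "f3 y" x z] B1[of x "f3 y" z] B1[of y "f3 x" z]
      by (simp add: N_def)
    \<comment> \<open>The cyclic identities move \<open>z\<close> into the slot of
      differentiation.\<close>
    also have "\<dots> = B1 z (f3 x) y + B1 z x (f3 y) + B2 z x y - B2 z (f3 x) (f3 y)"
      using S' cyclic(1)[of "f3 x" y z] cyclic(1)[of x "f3 y" z] cyclic(2)[of x y z]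
        cyclic(2)[of "f3 x" "f3 y" z] skew(1)[of y "f3 x" z] skew(1)[of "f3 y" x z]
        skew(2)[of y x z] skew(2)[of "f3 y" "f3 x" z] by simp
    \<comment> \<open>Only derivatives along \<open>z\<close> remain; they cancel by the product
      rules \<open>B1\<close> and \<open>B2\<close>.\<close>
    also have "\<dots> = 0"
      using S' B2[of z x y] B2[of z y x] B1[of z x "f3 y"] skew(1)[of z "f3 x" y]
        skew(2)[of z x y] skew(3)[of z "f1 y" x] by (simp add: f23)
    finally show ?thesis .
  qed
  have N: "N x y z = 0" if S: "x \<in> S" "y \<in> S" "z \<in> S" for x y z
  proof -
    have "N x y (f2 (f2 z)) = - N x y z"
      using S S[THEN closed(3)] by (simp add: N_def sq(2))
    then show ?thesis using N_f2[of x y "f2 z"] S closed(2) by simp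
  qed
  \<comment> \<open>The cyclic identities at \<open>f3 y, z, x\<close> and
    \<open>y, f3 z, x\<close>, with \<open>comm\<close>, turn \<open>N y z x\<close> into
    \<open>- 2 * B3 x (f3 y) z\<close>.\<close>
  have "B3 x (f3 y) z = 0" if S: "x \<in> S" "y \<in> S" "z \<in> S" for x y z
    using S S[THEN closed(3)] N[of y z x] cyclic(3)[of "f3 y" z x] cyclic(3)[of y "f3 z" x]
      skew(3)[of z "f3 y" x] skew(3)[of "f3 z" y x] comm[of x y z]
    by (simp add: N_def)
  then have "B3 x (f3 (f3 y)) z = 0" using xyz closed(3) by blast
  then show ?thesis
    using xyz sq(3)[of x z y] skew(3)[of x "f3 (f3 y)" z] skew(3)[of x y z] closed(3) by simp
qed

section \<open>The Okumura connection\<close>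

context sasaki_einstein_su2
begin

abbreviation E :: "'a connection" where "E \<equiv> okumura (1/2) D \<phi>3 \<xi> \<eta> g"

lemma E_vfield [simp]: "X \<in> V \<Longrightarrow> Y \<in> V \<Longrightarrow> E X Y \<in> V"
  unfolding okumura_def by (intro vfield_add vfield_diff vfield_scale) simp_all

text \<open>The difference of \<open>E\<close> and \<open>D\<close> in direction \<open>X\<close> is
  skew: \<open>\<phi>3\<close> is skew, and the \<open>\<xi>\<close> term cancels against the last
  one.\<close>

lemma E_metric:
  assumes "X \<in> V" "Y \<in> V" "Z \<in> V"
  shows "X p (\<lambda>q. g q (Y q) (Z q)) = g p (E X Y p) (Z p) + g p (Y p) (E X Z p)"
  using assms omega_skew[of "X p" p "Y p"] omega_skew[of "X p" p "Z p"]
  by (simp add: D_metric okumura_def g_phi_right)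

lemma E_xi: "X \<in> V \<Longrightarrow> E X \<xi> p = 0"
  by (simp add: okumura_def D_xi)

lemma E_eta: "X \<in> V \<Longrightarrow> Y \<in> V \<Longrightarrow> X p (\<lambda>q. \<eta> q (Y q)) = \<eta> p (E X Y p)"
  using E_metric[of X Y \<xi> p] by (simp add: E_xi)

text \<open>Used to differentiate the square of an almost contact endomorphism in
  \<open>B_comm\<close>.\<close>

lemma E_xi_diff:
  assumes "X \<in> V" "Y \<in> V" "smooth f"
  shows "E X (\<lambda>q. f q *\<^sub>R \<xi> q - Y q) p = X p f *\<^sub>R \<xi> p - E X Y p"
  using assms
  by (simp add: okumura_def D_diff[OF _ vfield_scale] D_scale D_xi algebra_simps)

lemma cov_endo_eta:
  assumes "almost_contact A \<psi> \<xi> \<eta> g" "X \<in> V" "Y \<in> V"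
  shows "\<eta> p (cov_endo E \<psi> X Y p) = 0"
proof -
  interpret J: almost_contact A \<psi> \<xi> \<eta> g by fact
  show ?thesis
    using assms E_eta[of X "\<lambda>q. \<psi> q (Y q)" p]
    by (simp add: cov_endo_def tangent_deriv_const[OF vfield_tangent[OF assms(2)]])
qed

lemma cov_endo_vfield:
  assumes "almost_contact A \<psi> \<xi> \<eta> g" "X \<in> V" "Y \<in> V"
  shows "cov_endo E \<psi> X Y \<in> V"
proof -
  interpret J: almost_contact A \<psi> \<xi> \<eta> g by fact
  show ?thesis using assms unfolding cov_endo_def by (intro vfield_diff) simp_all
qed

section \<open>Covariant derivatives of the endomorphisms as trilinear expressions\<close>

definition B :: "'a endo \<Rightarrow> 'a \<Rightarrow> 'a vfield \<Rightarrow> 'a vfield \<Rightarrow> 'a vfield \<Rightarrow> real" where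
  "B \<psi> p X Y Z = g p (cov_endo E \<psi> X Y p) (Z p)"

text \<open>Since \<open>E\<close> is metric, \<open>B\<close> is also the covariant derivative of
  the 2-form of \<open>\<psi>\<close>.\<close>

lemma B_eq:
  assumes "almost_contact A \<psi> \<xi> \<eta> g" "X \<in> V" "Y \<in> V" "Z \<in> V"
  shows "B \<psi> p X Y Z = X p (\<lambda>q. g q (\<psi> q (Y q)) (Z q)) + g p (\<psi> p (E X Z p)) (Y p)
    - g p (\<psi> p (E X Y p)) (Z p)"
proof -
  interpret J: almost_contact A \<psi> \<xi> \<eta> g by fact
  show ?thesis
    using assms J.omega_skew[of "Y p" p "E X Z p"] E_metric[of X "\<lambda>q. \<psi> q (Y q)" Z p]
    by (simp add: B_def cov_endo_def)
qed

lemma B_skew: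
  assumes "almost_contact A \<psi> \<xi> \<eta> g" "X \<in> V" "Y \<in> V" "Z \<in> V"
  shows "B \<psi> p X Y Z = - B \<psi> p X Z Y"
proof -
  interpret J: almost_contact A \<psi> \<xi> \<eta> g by fact
  have "(\<lambda>q. g q (\<psi> q (Y q)) (Z q)) = (\<lambda>q. - g q (\<psi> q (Z q)) (Y q))"
    using assms by (intro ext J.omega_skew) simp_all
  then show ?thesis
    using assms by (simp add: B_eq tangent_deriv_minus[OF vfield_tangent[OF assms(2)]])
qed

text \<open>The square of \<open>\<theta>\<close> is -1 up to a multiple of \<open>\<xi>\<close>,
  and that multiple is invisible to \<open>B\<close> by \<open>cov_endo_eta\<close>. Hence the
  hyper-Hermitian algebra applies.\<close>

lemma B_sq:
  assumes "almost_contact A \<psi> \<xi> \<eta> g" "almost_contact A \<theta> \<xi> \<eta> g" "X \<in> V" "Y \<in> V" "Z \<in> V"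
  shows "B \<psi> p X Y (\<lambda>q. \<theta> q (\<theta> q (Z q))) = - B \<psi> p X Y Z"
proof -
  interpret J: almost_contact A \<psi> \<xi> \<eta> g by fact
  interpret K: almost_contact A \<theta> \<xi> \<eta> g by fact
  show ?thesis
    using assms by (simp add: B_def cov_endo_eta cov_endo_vfield)
qed

text \<open>As \<open>\<eta>\<close> and \<open>\<xi>\<close> are parallel, differentiating the
  square of \<open>\<psi>\<close> shows that its derivative anticommutes with it.\<close>

lemma B_comm:
  assumes "almost_contact A \<psi> \<xi> \<eta> g" "X \<in> V" "Y \<in> V" "Z \<in> V"
  shows "B \<psi> p X (\<lambda>q. \<psi> q (Y q)) Z = B \<psi> p X Y (\<lambda>q. \<psi> q (Z q))"
proof -
  interpret J: almost_contact A \<psi> \<xi> \<eta> g by fact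
  have "(\<lambda>q. \<psi> q (\<psi> q (Y q))) = (\<lambda>q. \<eta> q (Y q) *\<^sub>R \<xi> q - Y q)"
    using assms by simp
  then have "cov_endo E \<psi> X (\<lambda>q. \<psi> q (Y q)) p = - \<psi> p (cov_endo E \<psi> X Y p)"
    using assms by (simp add: cov_endo_def E_xi_diff E_eta)
  then show ?thesis
    using assms by (simp add: B_def J.g_phi_right cov_endo_vfield)
qed

lemma B_mult:
  assumes "almost_contact A \<alpha> \<xi> \<eta> g" "almost_contact A \<beta> \<xi> \<eta> g"
    and mult: "\<And>p v. v \<in> T p \<Longrightarrow> \<alpha> p (\<beta> p v) = \<gamma> p v"
    and V: "X \<in> V" "Y \<in> V" "Z \<in> V"
  shows "B \<gamma> p X Y Z = B \<alpha> p X (\<lambda>q. \<beta> q (Y q)) Z - B \<beta> p X Y (\<lambda>q. \<alpha> q (Z q))"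
proof -
  interpret J: almost_contact A \<alpha> \<xi> \<eta> g by fact
  interpret K: almost_contact A \<beta> \<xi> \<eta> g by fact
  have "cov_endo E \<gamma> X Y p =
      cov_endo E \<alpha> X (\<lambda>q. \<beta> q (Y q)) p + \<alpha> p (cov_endo E \<beta> X Y p)"
    using V by (simp add: cov_endo_def flip: mult)
  then show ?thesis
    using V assms(1,2) by (simp add: B_def J.g_phi_right cov_endo_vfield)
qed

text \<open>The exterior derivative of \<open>\<omega>\<close> is the cyclic sum of \<open>E \<omega>\<close> plus a torsion term. The latter
  carries the factor \<open>1 + r\<close>, doubled for skew \<open>C\<close>; so \<open>r = 1/2\<close> is the parameter that
  reproduces the constant \<open>3\<close> in the Sasaki-Einstein equations.\<close>

lemma B_cyclic_sum:
  fixes p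
  assumes "almost_contact A \<psi> \<xi> \<eta> g" and V: "X \<in> V" "Y \<in> V" "Z \<in> V"
  defines "C \<equiv> \<lambda>X Y. g p (\<psi> p (\<phi>3 p (X p))) (Y p)"
  shows "B \<psi> p X Y Z + B \<psi> p Y Z X + B \<psi> p Z X Y =
    ext_deriv2 (\<lambda>q v w. g q (\<psi> q v) w) X Y Z p
    - 3 / 2 * (\<eta> p (X p) * (C Z Y - C Y Z) + \<eta> p (Y p) * (C X Z - C Z X)
      + \<eta> p (Z p) * (C Y X - C X Y))"
proof -
  interpret J: almost_contact A \<psi> \<xi> \<eta> g by fact
  \<comment> \<open>The torsion also has a \<open>\<xi>\<close> component, but \<open>\<psi>\<close>
    annihilates it.\<close>
  have torsion: "g p (\<psi> p (E X Y p)) (Z p) - g p (\<psi> p (E Y X p)) (Z p) =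
      g p (\<psi> p (lie_bracket X Y p)) (Z p) + 3 / 2 * (\<eta> p (Y p) * C X Z - \<eta> p (X p) * C Y Z)"
    if "X \<in> V" "Y \<in> V" "Z \<in> V" for X Y Z
    using that by (simp add: okumura_def D_torsion_free C_def algebra_simps)
  show ?thesis
    using V torsion[of X Y Z] torsion[of Y Z X] torsion[of Z X Y] assms(1)
    by (simp add: B_eq ext_deriv2_def algebra_simps)
qed

lemma almost_contacts:
  "almost_contact A \<phi>1 \<xi> \<eta> g" "almost_contact A \<phi>2 \<xi> \<eta> g" "almost_contact A \<phi>3 \<xi> \<eta> g"
  by unfold_locales

text \<open>For \<open>\<phi>1\<close> and \<open>\<phi>2\<close>, \<open>C\<close> is the skew form
  \<open>- \<omega>\<^sub>2\<close> or \<open>\<omega>\<^sub>1\<close>, and the torsion term cancels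
  the structure equation. For \<open>\<phi>3\<close>, \<open>C\<close> is symmetric and
  \<open>\<omega>\<^sub>3\<close> closed.\<close>

lemma B_cyclic:
  assumes V: "X \<in> V" "Y \<in> V" "Z \<in> V"
  shows "B \<phi>1 p X Y Z + B \<phi>1 p Y Z X + B \<phi>1 p Z X Y = 0"
    and "B \<phi>2 p X Y Z + B \<phi>2 p Y Z X + B \<phi>2 p Z X Y = 0"
    and "B \<phi>3 p X Y Z + B \<phi>3 p Y Z X + B \<phi>3 p Z X Y = 0"
proof -
  show "B \<phi>1 p X Y Z + B \<phi>1 p Y Z X + B \<phi>1 p Z X Y = 0"
    using V J2.omega_skew[of "X p" p "Y p"] J2.omega_skew[of "Y p" p "Z p"]
      J2.omega_skew[of "Z p" p "X p"]
    unfolding B_cyclic_sum[OF almost_contacts(1) V]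
    by (simp add: d_omega1 wedge12_def algebra_simps)
  show "B \<phi>2 p X Y Z + B \<phi>2 p Y Z X + B \<phi>2 p Z X Y = 0"
    using V J1.omega_skew[of "X p" p "Y p"] J1.omega_skew[of "Y p" p "Z p"]
      J1.omega_skew[of "Z p" p "X p"]
    unfolding B_cyclic_sum[OF almost_contacts(2) V]
    by (simp add: d_omega2 wedge12_def algebra_simps)
  show "B \<phi>3 p X Y Z + B \<phi>3 p Y Z X + B \<phi>3 p Z X Y = 0"
    using V g_commute[of "X p" p "Y p"] g_commute[of "Y p" p "Z p"] g_commute[of "Z p" p "X p"]
    unfolding B_cyclic_sum[OF almost_contacts(3) V]
    by (simp add: d_omega3 algebra_simps)
qed

lemma B_zero:
  assumes V: "X \<in> V" "Y \<in> V" "Z \<in> V"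
  shows "B \<phi>1 p X Y Z = 0" and "B \<phi>2 p X Y Z = 0" and "B \<phi>3 p X Y Z = 0"
proof -
  define f1 f2 f3 where f_def: "f1 = (\<lambda>X :: 'a vfield. \<lambda>q. \<phi>1 q (X q))"
    "f2 = (\<lambda>X :: 'a vfield. \<lambda>q. \<phi>2 q (X q))" "f3 = (\<lambda>X :: 'a vfield. \<lambda>q. \<phi>3 q (X q))"
  have closed: "f1 X \<in> V" "f2 X \<in> V" "f3 X \<in> V" if "X \<in> V" for X
    using that by (simp_all add: f_def)
  have mult: "f1 (f2 X) = f3 X" "f2 (f3 X) = f1 X" "f3 (f1 X) = f2 X" if "X \<in> V" for X
    using that by (simp_all add: f_def)
  have sq: "B \<psi> p X Y (f1 (f1 Z)) = - B \<psi> p X Y Z" "B \<psi> p X Y (f2 (f2 Z)) = - B \<psi> p X Y Z"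
    "B \<psi> p X Y (f3 (f3 Z)) = - B \<psi> p X Y Z"
    if "almost_contact A \<psi> \<xi> \<eta> g" "X \<in> V" "Y \<in> V" "Z \<in> V" for \<psi> X Y Z
    unfolding f_def using that almost_contacts by (blast intro: B_sq)+
  have comm: "B \<phi>1 p X (f1 Y) Z = B \<phi>1 p X Y (f1 Z)" "B \<phi>2 p X (f2 Y) Z = B \<phi>2 p X Y (f2 Z)"
    "B \<phi>3 p X (f3 Y) Z = B \<phi>3 p X Y (f3 Z)" if "X \<in> V" "Y \<in> V" "Z \<in> V" for X Y Z
    unfolding f_def using that almost_contacts by (blast intro: B_comm)+
  have B_mults: "B \<phi>1 p X Y Z = B \<phi>2 p X (f3 Y) Z - B \<phi>3 p X Y (f2 Z)"
    "B \<phi>2 p X Y Z = B \<phi>3 p X (f1 Y) Z - B \<phi>1 p X Y (f3 Z)"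
    "B \<phi>3 p X Y Z = B \<phi>1 p X (f2 Y) Z - B \<phi>2 p X Y (f1 Z)"
    if "X \<in> V" "Y \<in> V" "Z \<in> V" for X Y Z
    unfolding f_def using that almost_contacts by (auto intro!: B_mult)
  note facts = closed B_cyclic B_mults sq[OF almost_contacts(1)] sq[OF almost_contacts(2)]
    sq[OF almost_contacts(3)] mult comm almost_contacts[THEN B_skew] V
  \<comment> \<open>\<open>hitchin_algebra\<close> treats only its third form, so it is applied to
    each cyclic rotation of the indices.\<close>
  show "B \<phi>3 p X Y Z = 0"
    by (rule hitchin_algebra[of V f1 f2 f3 "B \<phi>1 p" "B \<phi>2 p" "B \<phi>3 p"]) (fact facts)+
  show "B \<phi>1 p X Y Z = 0"
    by (rule hitchin_algebra[of V f2 f3 f1 "B \<phi>2 p" "B \<phi>3 p" "B \<phi>1 p"]) (fact facts)+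
  show "B \<phi>2 p X Y Z = 0"
    by (rule hitchin_algebra[of V f3 f1 f2 "B \<phi>3 p" "B \<phi>1 p" "B \<phi>2 p"]) (fact facts)+
qed

lemma cov_endo_eq_zeroI:
  assumes "almost_contact A \<psi> \<xi> \<eta> g" "X \<in> V" "Y \<in> V" "\<And>p Z. Z \<in> V \<Longrightarrow> B \<psi> p X Y Z = 0"
  shows "cov_endo E \<psi> X Y = 0"
proof
  fix p
  show "cov_endo E \<psi> X Y p = 0 p"
    using vfield_eq_zeroI[OF cov_endo_vfield[OF assms(1-3)], of p] assms(4) by (simp add: B_def)
qed

lemma parallel_phi: "parallel_endo A E \<phi>1" "parallel_endo A E \<phi>2" "parallel_endo A E \<phi>3"
  using almost_contacts by (simp_all add: parallel_endo_def cov_endo_eq_zeroI B_zero)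

lemma parallel_xi: "parallel_vfield A E \<xi>"
  unfolding parallel_vfield_def by (auto simp: fun_eq_iff E_xi)

lemma parallel_eta: "parallel_form1 A E \<eta>"
  by (simp add: parallel_form1_def cov_form1_def E_eta)

lemma parallel_metric: "parallel_tensor2 A E g"
  by (simp add: parallel_tensor2_def cov_tensor2_def E_metric)

lemma sasakian: "sasakian A D \<phi>3 \<xi> \<eta> g"
  unfolding sasakian_def
proof (intro conjI ballI almost_contact_metric ext)
  fix X Y p assume V: "X \<in> V" "Y \<in> V"
  have "cov_endo E \<phi>3 X Y p = 0"
    using parallel_phi(3) V by (simp add: parallel_endo_def)
  \<comment> \<open>The terms with parameter 1/2 cancel in the commutator with
    \<open>\<phi>3\<close>; the other corrections give the Sasakian right-hand side.\<close>
  then have "cov_endo D \<phi>3 X Y p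
      = g p (X p) (Y p) *\<^sub>R \<xi> p - \<eta> p (Y p) *\<^sub>R X p"
    using V by (simp add: cov_endo_def okumura_def algebra_simps)
  then show "cov_endo D \<phi>3 X Y p f = (g p (X p) (Y p) *\<^sub>R \<xi> p - \<eta> p (Y p) *\<^sub>R X p) f" for f
    by simp
qed

end

theorem proposition7p6:
  fixes A :: "('a::{t2_space, second_countable_topology}, real ^ 5) chart set"
    and \<phi> :: "nat \<Rightarrow> 'a endo" and \<xi> :: "'a vfield" and \<eta> :: "'a form1"
    and g :: "'a tensor2" and \<omega> :: "nat \<Rightarrow> 'a tensor2" and nabla :: "'a connection"
  assumes "smooth_manifold A"
    and "su2_structure A \<phi> \<xi> \<eta> g"
    and "associated_forms A \<phi> g \<omega>"
    and "sasaki_einstein A \<eta> \<omega>"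
    and "levi_civita A g nabla"
  shows "sasakian A nabla (\<phi> 3) \<xi> \<eta> g \<and>
         parallelizes_su2 A (okumura (1/2) nabla (\<phi> 3) \<xi> \<eta> g) \<phi> \<xi> \<eta> g"
proof -
  interpret manifold A using assms(1) by (rule manifold.intro)
  have contact: "almost_contact A (\<phi> i) \<xi> \<eta> g" if "i \<in> {1, 2, 3}" for i
    using assms(2) that unfolding su2_structure_def
    by (intro almost_contact.intro manifold_axioms almost_contact_axioms.intro) blast
  have mult: "\<phi> i p (\<phi> j p v) = \<phi> k p v \<and> \<phi> j p (\<phi> i p v) = - \<phi> k p v"
    if "(i, j, k) \<in> {(1, 2, 3), (2, 3, 1), (3, 1, 2)}" "v \<in> T p" for i j k p v
    using assms(2) that unfolding su2_structure_def by blast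
  have su2: "su2 A (\<phi> 1) (\<phi> 2) (\<phi> 3) \<xi> \<eta> g"
    by (intro su2.intro su2_axioms.intro contact)
      (use mult[of 1 2 3] mult[of 2 3 1] mult[of 3 1 2] in blast)+
  have \<omega>: "\<omega> i p v w = g p (\<phi> i p v) w" if "i \<in> {1, 2, 3}" "v \<in> T p" "w \<in> T p" for i p v w
    using assms(3) that unfolding associated_forms_def by blast
  \<comment> \<open>\<open>\<omega>\<close> is prescribed on tangent vectors only, so the transfer
    is made after evaluation on fields.\<close>
  have ext_deriv2: "ext_deriv2 (\<lambda>q v w. g q (\<phi> i q v) w) X Y Z p = ext_deriv2 (\<omega> i) X Y Z p"
    if "i \<in> {1, 2, 3}" "X \<in> V" "Y \<in> V" "Z \<in> V" for i X Y Z p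
    using that(2-4) by (simp add: ext_deriv2_def \<omega>[OF that(1)])
  have wedge: "wedge12 \<eta> (\<lambda>q v w. g q (\<phi> i q v) w) p u v w = wedge12 \<eta> (\<omega> i) p u v w"
    if "i \<in> {1, 2, 3}" "u \<in> T p" "v \<in> T p" "w \<in> T p" for i p u v w
    using that(2-4) by (simp add: wedge12_def \<omega>[OF that(1)])
  interpret sasaki_einstein_su2 A "\<phi> 1" "\<phi> 2" "\<phi> 3" \<xi> \<eta> g nabla
  proof (intro sasaki_einstein_su2.intro su2 sasaki_einstein_su2_axioms.intro assms(5))
    fix X Y Z p assume V: "X \<in> V" "Y \<in> V" "Z \<in> V"
    show "ext_deriv2 (\<lambda>q v w. g q (\<phi> 1 q v) w) X Y Z p
        = 3 * wedge12 \<eta> (\<lambda>q v w. g q (\<phi> 2 q v) w) p (X p) (Y p) (Z p)"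
      using assms(4) V ext_deriv2[of 1 X Y Z p] wedge[of 2 "X p" p "Y p" "Z p"]
      unfolding sasaki_einstein_def by simp
    show "ext_deriv2 (\<lambda>q v w. g q (\<phi> 2 q v) w) X Y Z p
        = - 3 * wedge12 \<eta> (\<lambda>q v w. g q (\<phi> 1 q v) w) p (X p) (Y p) (Z p)"
      using assms(4) V ext_deriv2[of 2 X Y Z p] wedge[of 1 "X p" p "Y p" "Z p"]
      unfolding sasaki_einstein_def by simp
  next
    fix X Y p assume V: "X \<in> V" "Y \<in> V"
    show "ext_deriv1 \<eta> X Y p = - 2 * g p (\<phi> 3 p (X p)) (Y p)"
      using assms(4) V \<omega>[of 3 "X p" p "Y p"] unfolding sasaki_einstein_def by simp
  qed
  show ?thesis
    using sasakian parallel_phi parallel_xi parallel_eta parallel_metric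
    by (simp add: parallelizes_su2_def)
qed

end
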